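(* Let $r,k,n$ be integers with $r\ge 2k+1\ge 3$ and $n\ge 2r-1$, and let $\mathcal{M}$ be a rank $r$ Lawrence oriented matroid on $n$ elements. Then $$f_{\mathcal{M}}(r,n,k)\le c_r(n,k)+2\left(\sum_{i=r-2k}^{r-1}\binom{n-1}{i}-\sum_{i=4}^{2k+3}\binom{n-3\left\lfloor\frac{i-1}{2}\right\rfloor+1+(i \bmod 2)}{r+3-i}\right),$$ where $i \bmod 2\in\{0,1\}$ is the remainder of $i$ modulo $2$.
   Context: An oriented matroid $\mathcal{M}=(E,\mathcal{C})$ is given by its finite ground set $E$ and its set $\mathcal{C}\subseteq\{+,-,0\}^E$ of signed circuits; for a sign vector $X$, $X^+$ and $X^-$ are the sets of positive and negative elements and $\underline{X}=X^+\cup X^-$ is the support. All oriented matroids are simple (all circuits have size at least $3$). For $R\subseteq E$, the reorientation ${}_{-R}\mathcal{M}$ is obtained from $\mathcal{M}$ by reversing the sign of $X_e$ for every $e\in R$ and every circuit $X$. For an integer $k\ge 0$, $\mathcal{M}$ is $k$-neighborly if $|X^+|>k$ and $|X^-|>k$ for every circuit $X$. For an oriented matroid $\mathcal{M}$ of rank $r$ on $n$ elements, $f_{\mathcal{M}}(r,n,k)$ denotes the number of subsets $R\subseteq E$ such that ${}_{-R}\mathcal{M}$ is $k$-neighborly. The alternating oriented matroid $C_r(n)$ is the uniform oriented matroid of rank $r$ on $[n]=\{1,\dots,n\}$ in which every circuit $X$ with support $i_1<\dots<i_{r+1}$ satisfies $X_{i_j}=-X_{i_{j+1}}$ for $1\le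 j\le r$. Put $c_r(n,k)=f_{C_r(n)}(r,n,k)$. Lawrence oriented matroid (LOM): for an $r\times n$ matrix $A=(a_{i,j})$ with entries in $\{+1,-1\}$, $r\le n$, $\mathcal{M}_A$ is the uniform oriented matroid of rank $r$ on $[n]$ with chirotope $\chi(j_1,\dots,j_r)=\prod_{i=1}^r a_{i,j_i}$ for $j_1<\dots<j_r$. Equivalently, its circuits are the sign vectors $X$ with support $j_1<\dots<j_{r+1}$ such that $X_{j_{i+1}}=-X_{j_i}a_{i,j_i}a_{i,j_{i+1}}$ for $1\le i\le r$. A rank $r$ LOM on $n$ elements is an oriented matroid of the form $\mathcal{M}_A$ for such a matrix $A$. *)

theory Defs
  imports Main
begin

text \<open>
  A sign vector is an integer-valued function with values in \<open>{-1, 0, 1}\<close>; sign vectors on a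
  ground set \<open>E\<close> are extended by \<open>0\<close> outside \<open>E\<close>.
\<close>

definition sign_vector_on :: "'a set \<Rightarrow> ('a \<Rightarrow> int) \<Rightarrow> bool" where
  "sign_vector_on E X \<longleftrightarrow> range X \<subseteq> {-1, 0, 1} \<and> {e. X e \<noteq> 0} \<subseteq> E"

definition pos_part :: "('a \<Rightarrow> int) \<Rightarrow> 'a set" where
  "pos_part X = {e. X e > 0}"

definition neg_part :: "('a \<Rightarrow> int) \<Rightarrow> 'a set" where
  "neg_part X = {e. X e < 0}"

definition supp :: "('a \<Rightarrow> int) \<Rightarrow> 'a set" where
  "supp X = pos_part X \<union> neg_part X"

record 'a signed_system =
  ground :: "'a set"
  circuits :: "('a \<Rightarrow> int) set"

text \<open>
  The signed circuit axioms. The last assumption is simplicity, a standing assumption on all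
  oriented matroids here and not part of the usual axioms.
\<close>

locale oriented_matroid =
  fixes M :: "'a signed_system"
  assumes finite_ground: "finite (ground M)"
    and circuit_sign_vector: "X \<in> circuits M \<Longrightarrow> sign_vector_on (ground M) X"
    and circuit_nonempty: "X \<in> circuits M \<Longrightarrow> supp X \<noteq> {}"
    and circuit_symmetric: "X \<in> circuits M \<Longrightarrow> (\<lambda>e. - X e) \<in> circuits M"
    and circuit_incomparable:
      "\<lbrakk>X \<in> circuits M; Y \<in> circuits M; supp X \<subseteq> supp Y\<rbrakk> \<Longrightarrow> X = Y \<or> X = (\<lambda>e. - Y e)"
    and circuit_elimination:
      "\<lbrakk>X \<in> circuits M; Y \<in> circuits M; X \<noteq> (\<lambda>e. - Y e); e \<in> pos_part X \<inter> neg_part Y\<rbrakk>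
        \<Longrightarrow> \<exists>Z \<in> circuits M. pos_part Z \<subseteq> (pos_part X \<union> pos_part Y) - {e} \<and>
                            neg_part Z \<subseteq> (neg_part X \<union> neg_part Y) - {e}"
    and simple: "X \<in> circuits M \<Longrightarrow> card (supp X) \<ge> 3"

definition reorient :: "'a set \<Rightarrow> 'a signed_system \<Rightarrow> 'a signed_system" where
  "reorient R M =
     \<lparr>ground = ground M,
      circuits = (\<lambda>X e. if e \<in> R then - X e else X e) ` circuits M\<rparr>"

definition neighborly :: "nat \<Rightarrow> 'a signed_system \<Rightarrow> bool" where
  "neighborly k M \<longleftrightarrow> (\<forall>X \<in> circuits M. card (pos_part X) > k \<and> card (neg_part X) > k)"

text \<open>
  The number \<open>f_M(r,n,k)\<close>; the rank \<open>r\<close> and the number \<open>n\<close> of elements are determined by \<open>M\<close> and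
  are not repeated as arguments.
\<close>

definition num_neighborly :: "'a signed_system \<Rightarrow> nat \<Rightarrow> nat" where
  "num_neighborly M k = card {R. R \<subseteq> ground M \<and> neighborly k (reorient R M)}"

text \<open>The support of \<open>X\<close> is \<open>j 1 < \<dots> < j (r+1)\<close>.\<close>

definition has_support :: "nat \<Rightarrow> (nat \<Rightarrow> int) \<Rightarrow> (nat \<Rightarrow> nat) \<Rightarrow> bool" where
  "has_support r X j \<longleftrightarrow> strict_mono_on {1..r+1} j \<and> supp X = j ` {1..r+1}"

definition alternating_om :: "nat \<Rightarrow> nat \<Rightarrow> nat signed_system" where
  "alternating_om r n =
     \<lparr>ground = {1..n},
      circuits = {X. sign_vector_on {1..n} X \<and>
        (\<exists>j. has_support r X j \<and> (\<forall>i\<in>{1..r}. X (j i) = - X (j (i+1))))}\<rparr>"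

definition num_neighborly_alternating :: "nat \<Rightarrow> nat \<Rightarrow> nat \<Rightarrow> nat" where
  "num_neighborly_alternating r n k = num_neighborly (alternating_om r n) k"

definition sign_matrix :: "nat \<Rightarrow> nat \<Rightarrow> (nat \<Rightarrow> nat \<Rightarrow> int) \<Rightarrow> bool" where
  "sign_matrix r n A \<longleftrightarrow> (\<forall>i\<in>{1..r}. \<forall>j\<in>{1..n}. A i j \<in> {1, -1})"

definition matrix_om :: "nat \<Rightarrow> nat \<Rightarrow> (nat \<Rightarrow> nat \<Rightarrow> int) \<Rightarrow> nat signed_system" where
  "matrix_om r n A =
     \<lparr>ground = {1..n},
      circuits = {X. sign_vector_on {1..n} X \<and>
        (\<exists>j. has_support r X j \<and>
             (\<forall>i\<in>{1..r}. X (j (i+1)) = - X (j i) * A i (j i) * A i (j (i+1))))}\<rparr>"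

definition lawrence_om :: "nat \<Rightarrow> nat \<Rightarrow> nat signed_system \<Rightarrow> bool" where
  "lawrence_om r n M \<longleftrightarrow>
     oriented_matroid M \<and> r \<le> n \<and> (\<exists>A. sign_matrix r n A \<and> M = matrix_om r n A)"

text \<open>
  The circuits of \<open>matrix_om r n A\<close> are those of the uniform oriented matroid with chirotope
  \<open>\<chi>(j 1, \<dots>, j r) = (\<Prod>i. A i (j i))\<close>: consecutive signs of a circuit \<open>X\<close> with support
  \<open>j 1 < \<dots> < j (r+1)\<close> are related by
  \<open>X (j (i+1)) = - X (j i) * \<chi>(j without j i) * \<chi>(j without j (i+1))\<close>,
  and the product of the two chirotope values is evaluated in the lemma below.
\<close>

definition chirotope :: "nat \<Rightarrow> (nat \<Rightarrow> nat \<Rightarrow> int) \<Rightarrow> (nat \<Rightarrow> nat) \<Rightarrow> int" where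
  "chirotope r A j = (\<Prod>i=1..r. A i (j i))"

definition omit :: "nat \<Rightarrow> (nat \<Rightarrow> nat) \<Rightarrow> nat \<Rightarrow> nat" where
  "omit q j i = (if i < q then j i else j (i+1))"

lemma chirotope_omit_mult:
  assumes A: "sign_matrix r n A" and j: "j ` {1..r+1} \<subseteq> {1..n}" and i: "i \<in> {1..r}"
  shows "chirotope r A (omit i j) * chirotope r A (omit (i+1) j) = A i (j i) * A i (j (i+1))"
proof -
  define g where "g = (\<lambda>m. A m (omit i j m) * A m (omit (i+1) j m))"
  have g1: "g m = 1" if m: "m \<in> {1..r} - {i}" for m
  proof -
    have eq: "omit (i+1) j m = omit i j m"
      using m by (auto simp: omit_def)
    have "omit i j m \<in> {1..n}"
      using j m by (auto simp: omit_def image_subset_iff)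
    then have "A m (omit i j m) \<in> {1, -1}"
      using A m by (auto simp: sign_matrix_def)
    then show ?thesis
      using eq by (auto simp: g_def)
  qed
  have "chirotope r A (omit i j) * chirotope r A (omit (i+1) j) = prod g {1..r}"
    by (simp add: chirotope_def g_def prod.distrib)
  also have "\<dots> = g i * prod g ({1..r} - {i})"
    using i by (simp add: prod.remove)
  also have "prod g ({1..r} - {i}) = 1"
    using g1 by (simp add: prod.neutral)
  also have "g i * 1 = A i (j i) * A i (j (i+1))"
    by (simp add: g_def omit_def mult.commute)
  finally show ?thesis .
qed

end

theory Submission
  imports Defs
begin

text \<open>
  Reorienting \<open>M\<^sub>A\<close> along \<open>R\<close> multiplies the columns of \<open>A\<close> in \<open>R\<close> by \<open>-1\<close>. In the resulting
  matrix one travels from the top left entry: walk to the right in the current row, and whenever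
  the sign of the entry in that row changes from one column to the next, turn there, that is,
  continue in the row below. The first column together with the turns \<open>t\<^sub>1 < t\<^sub>2 < \<dots>\<close> is the
  beginning of the support of a circuit all of whose signs agree, because consecutive circuit
  signs agree exactly if the two entries in the relevant row differ. The set of turns, a subset of
  \<open>{2..n}\<close>, and the answer to the question whether \<open>1 \<in> R\<close> determine \<open>R\<close>, and every such pair
  occurs (\<open>turns_image\<close>). Hence it suffices to count sets of turns, and every count is doubled.

  If there are \<open>r\<close> turns or more, then the first column and the first \<open>r\<close> turns carry a circuit
  with constant sign, so a \<open>k\<close>-neighborly \<open>R\<close> has at most \<open>r - 1\<close> turns. This alone gives at most
  \<open>2 * (\<Sum>i<r. (n - 1) choose i)\<close> such \<open>R\<close>. Among the sets of fewer than \<open>r\<close> turns many are still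
  excluded. If the last turn is far from column \<open>n\<close>, the constant beginning of a circuit
  can be completed in the remaining columns at a low cost: any three columns contain two that
  continue the circuit with at most one negative sign (\<open>signed_chain_two_more\<close>). So with
  \<open>r - 2 * m\<close> turns and \<open>3 * m\<close> columns to the right of them there is a circuit with at most \<open>m\<close>
  negative elements; the same is true with \<open>r + 1 - 2 * m\<close> turns and \<open>3 * m - 2\<close> further columns,
  where one extra column supplies one element and \<open>m - 1\<close> triples supply the rest. For
  \<open>m = 1, \<dots>, k\<close> these families have pairwise different cardinalities of their members, and their
  sizes are the summands of the second sum of the theorem.

  For the alternating oriented matroid all entries of \<open>A\<close> are \<open>1\<close>, and the turns are the places at
  which membership in \<open>R\<close> changes. With fewer than \<open>r - 2 * k\<close> of them the signs of each
  reoriented circuit change more than \<open>2 * k\<close> times, and so there are more than \<open>k\<close> of each sign.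
  Thus \<open>c_r(n,k)\<close> is at least \<open>2 * (\<Sum>i<r-2*k. (n - 1) choose i)\<close>
  (\<open>num_neighborly_alternating_ge\<close>), which turns the first bound into the claimed one.
\<close>

section \<open>The travel through a reoriented sign matrix\<close>

text \<open>
  The sign of an entry after the columns in \<open>R\<close> have been negated. A truth value is meaningful also
  outside the matrix, where \<open>A\<close> is arbitrary; in this way a travel with more than \<open>r\<close> turns may
  simply run out of the matrix at the bottom.
\<close>

definition pos_entry :: "(nat \<Rightarrow> nat \<Rightarrow> int) \<Rightarrow> nat set \<Rightarrow> nat \<Rightarrow> nat \<Rightarrow> bool" where
  "pos_entry A R i c \<longleftrightarrow> (A i c = 1 \<longleftrightarrow> c \<notin> R)"

text \<open>
  The row of the travel when it leaves column \<open>c\<close>. Columns start at \<open>1\<close>; the value at \<open>0\<close> only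
  starts the recursion, and no turn takes place at column \<open>1\<close>.
\<close>

primrec travel_row :: "(nat \<Rightarrow> nat \<Rightarrow> int) \<Rightarrow> nat set \<Rightarrow> nat \<Rightarrow> nat" where
  "travel_row A R 0 = 1"
| "travel_row A R (Suc c) =
     (if c \<noteq> 0 \<and> pos_entry A R (travel_row A R c) c \<noteq> pos_entry A R (travel_row A R c) (Suc c)
      then Suc (travel_row A R c) else travel_row A R c)"

definition turns :: "(nat \<Rightarrow> nat \<Rightarrow> int) \<Rightarrow> nat set \<Rightarrow> nat \<Rightarrow> nat set" where
  "turns A R n = {c \<in> {2..n}. travel_row A R c \<noteq> travel_row A R (c - 1)}"

lemma turns_subset: "turns A R n \<subseteq> {2..n}"
  by (auto simp: turns_def)

lemma finite_turns [simp]: "finite (turns A R n)"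
  by (simp add: turns_def)

lemma turns_restrict: "m \<le> n \<Longrightarrow> turns A R m = turns A R n \<inter> {..m}"
  by (auto simp: turns_def)

lemma Suc_mem_turns_iff:
  assumes "1 \<le> c" "c < n"
  shows "Suc c \<in> turns A R n \<longleftrightarrow>
    pos_entry A R (travel_row A R c) c \<noteq> pos_entry A R (travel_row A R c) (Suc c)"
  using assms by (auto simp: turns_def)

lemma travel_row_eq_card: "travel_row A R c = Suc (card (turns A R c))"
proof (induction c)
  case 0
  then show ?case by (simp add: turns_def)
next
  case (Suc c)
  show ?case
  proof (cases "travel_row A R (Suc c) = travel_row A R c")
    case True
    then have "turns A R (Suc c) = turns A R c"
      by (auto simp: turns_def le_Suc_eq)
    with True Suc show ?thesis by simp
  next
    case False
    then have c: "c \<noteq> 0" and "travel_row A R (Suc c) = Suc (travel_row A R c)"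
      by (auto split: if_splits)
    moreover have "turns A R (Suc c) = insert (Suc c) (turns A R c)"
      using c False by (auto simp: turns_def le_Suc_eq)
    moreover have "Suc c \<notin> turns A R c"
      by (simp add: turns_def)
    ultimately show ?thesis using Suc by simp
  qed
qed

lemma travel_row_mono: "c \<le> d \<Longrightarrow> travel_row A R c \<le> travel_row A R d"
  by (simp add: travel_row_eq_card turns_restrict[of c d] card_mono)

lemma pos_entry_constant_on_row:
  assumes "1 \<le> c" "c \<le> d" "travel_row A R c = travel_row A R d"
  shows "pos_entry A R (travel_row A R d) c = pos_entry A R (travel_row A R d) d"
proof -
  have "turns A R c = turns A R d"
    using assms(2,3) turns_restrict[OF assms(2), of A R]
    by (intro card_subset_eq) (auto simp: travel_row_eq_card)
  have "pos_entry A R (travel_row A R d) e = pos_entry A R (travel_row A R d) c" if "c \<le> e" "e \<le> d" for e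
    using that
  proof (induction e rule: dec_induct)
    case base
    show ?case by (rule refl)
  next
    case (step e)
    have "Suc e \<notin> turns A R d"
      using \<open>turns A R c = turns A R d\<close> step.hyps turns_subset[of A R c] by fastforce
    moreover have "travel_row A R e = travel_row A R d"
      using travel_row_mono[of c e A R] travel_row_mono[of e d A R] step assms(3) by linarith
    ultimately show ?case
      using Suc_mem_turns_iff[of e d A R] assms(1) step by simp
  qed
  then show ?thesis using assms(2) by blast
qed

text \<open>
  The travel up to column \<open>c\<close> fixes the current row, and whether it turns at the next column then
  tells the sign of the next entry in this row relative to the present one. So membership in \<open>R\<close>
  can be read off column by column.
\<close>

lemma turns_inj:
  "inj_on (\<lambda>R. (1 \<in> R, turns A R n)) (Pow {1..n})"
proof (rule inj_onI)
  fix R S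
  assume RS: "R \<in> Pow {1..n}" "S \<in> Pow {1..n}"
    and eq: "(1 \<in> R, turns A R n) = (1 \<in> S, turns A S n)"
  have "c \<in> R \<longleftrightarrow> c \<in> S" if "1 \<le> c" "c \<le> n" for c
    using that
  proof (induction c rule: dec_induct)
    case base
    then show ?case using eq by simp
  next
    case (step c)
    have row: "travel_row A R c = travel_row A S c"
      using eq step.prems by (simp add: travel_row_eq_card turns_restrict[of c n])
    show ?case
      using Suc_mem_turns_iff[of c n A R] Suc_mem_turns_iff[of c n A S] eq row step
      by (auto simp: pos_entry_def)
  qed
  then show "R = S" using RS by auto
qed

text \<open>
  By injectivity and \<open>2 ^ n = 2 * 2 ^ (n - 1)\<close>, every set of turns is attained.
\<close>

lemma turns_image:
  assumes "1 \<le> n"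
  shows "(\<lambda>R. (1 \<in> R, turns A R n)) ` Pow {1..n} = UNIV \<times> Pow {2..n}"
proof (rule card_subset_eq)
  show "finite ((UNIV :: bool set) \<times> Pow {2..n})" by simp
  show "(\<lambda>R. (1 \<in> R, turns A R n)) ` Pow {1..n} \<subseteq> UNIV \<times> Pow {2..n}"
    using turns_subset by auto
  obtain m where "n = Suc m" using assms by (cases n) auto
  then show "card ((\<lambda>R. (1 \<in> R, turns A R n)) ` Pow {1..n}) = card ((UNIV::bool set) \<times> Pow {2..n})"
    unfolding card_image[OF turns_inj] by (simp add: card_cartesian_product card_Pow)
qed

lemma card_turns_in:
  assumes "1 \<le> n" "\<T> \<subseteq> Pow {2..n}"
  shows "card {R. R \<subseteq> {1..n} \<and> turns A R n \<in> \<T>} = 2 * card \<T>"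
proof -
  let ?f = "\<lambda>R. (1 \<in> R, turns A R n)"
  let ?S = "{R. R \<subseteq> {1..n} \<and> turns A R n \<in> \<T>}"
  have "?f ` ?S = (UNIV :: bool set) \<times> \<T>"
  proof (rule equalityI; rule subsetI)
    fix p assume "p \<in> ?f ` ?S"
    then show "p \<in> (UNIV :: bool set) \<times> \<T>" by auto
  next
    fix p assume p: "p \<in> (UNIV :: bool set) \<times> \<T>"
    then have "p \<in> ?f ` Pow {1..n}"
      using assms(2) unfolding turns_image[OF assms(1)] by auto
    then show "p \<in> ?f ` ?S" using p by auto
  qed
  moreover have "inj_on ?f ?S"
    by (rule inj_on_subset[OF turns_inj]) auto
  ultimately have "card ?S = card ((UNIV :: bool set) \<times> \<T>)"
    using card_image[of ?f ?S] by simp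
  then show ?thesis by (simp add: card_cartesian_product)
qed

section \<open>Circuits with few negative elements\<close>

text \<open>
  \<open>signed_chain A R i c w m\<close>: on some increasing sequence of \<open>i\<close> columns ending in \<open>c\<close>, the rule
  for the signs of a reoriented circuit, started with a positive sign, produces \<open>m\<close> negative signs,
  and \<open>w\<close> tells whether the last sign is positive. The step from the \<open>i\<close>-th element to the next one
  uses row \<open>i\<close> of the matrix, and the sign is kept if and only if the two entries in this row differ.
\<close>

inductive signed_chain :: "(nat \<Rightarrow> nat \<Rightarrow> int) \<Rightarrow> nat set \<Rightarrow> nat \<Rightarrow> nat \<Rightarrow> bool \<Rightarrow> nat \<Rightarrow> bool"
  for A R where
  start: "0 < c \<Longrightarrow> signed_chain A R 1 c True 0"
| step: "\<lbrakk>signed_chain A R i c w m; c < d; w' \<longleftrightarrow> (w \<longleftrightarrow> pos_entry A R i c \<noteq> pos_entry A R i d)\<rbrakk>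
    \<Longrightarrow> signed_chain A R (Suc i) d w' (if w' then m else Suc m)"

lemma signed_chain_sequence:
  assumes "signed_chain A R i c w m"
  shows "\<exists>j v. 1 \<le> i \<and> strict_mono_on {1..i} j \<and> j ` {1..i} \<subseteq> {1..c} \<and> j i = c \<and> v i = w \<and>
    (\<forall>q\<in>{1..<i}. v (q+1) \<longleftrightarrow> (v q \<longleftrightarrow> pos_entry A R q (j q) \<noteq> pos_entry A R q (j (q+1)))) \<and>
    card {q\<in>{1..i}. \<not> v q} = m"
  using assms
proof induction
  case (start c)
  then show ?case
    by (intro exI[of _ "\<lambda>_. c"] exI[of _ "\<lambda>_. True"]) (auto simp: strict_mono_on_def)
next
  case (step i c w m d w')
  then obtain j v where j: "1 \<le> i" "strict_mono_on {1..i} j" "j ` {1..i} \<subseteq> {1..c}" "j i = c"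
    "v i = w" "\<forall>q\<in>{1..<i}. v (q+1) \<longleftrightarrow> (v q \<longleftrightarrow> pos_entry A R q (j q) \<noteq> pos_entry A R q (j (q+1)))"
    "card {q\<in>{1..i}. \<not> v q} = m"
    by blast
  let ?j = "j(Suc i := d)" and ?v = "v(Suc i := w')"
  have jd: "j q < d \<and> 1 \<le> j q" if "q \<in> {1..i}" for q
    using j(3) that step.hyps(2) by fastforce
  have "strict_mono_on {1..Suc i} ?j"
    using j(2) jd by (auto simp: strict_mono_on_def le_Suc_eq)
  moreover have "?j ` {1..Suc i} \<subseteq> {1..d}"
    using jd step.hyps(2) by (auto simp: le_Suc_eq less_imp_le)
  moreover have "\<forall>q\<in>{1..<Suc i}.
      ?v (q+1) \<longleftrightarrow> (?v q \<longleftrightarrow> pos_entry A R q (?j q) \<noteq> pos_entry A R q (?j (q+1)))"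
  proof
    fix q assume "q \<in> {1..<Suc i}"
    then consider "q \<in> {1..<i}" | "q = i" by fastforce
    then show "?v (q+1) \<longleftrightarrow> (?v q \<longleftrightarrow> pos_entry A R q (?j q) \<noteq> pos_entry A R q (?j (q+1)))"
    proof cases
      case 1
      then show ?thesis using bspec[OF j(6) 1] by simp
    next
      case 2
      then show ?thesis using j(4,5) step.hyps(3) by simp
    qed
  qed
  moreover have "card {q\<in>{1..Suc i}. \<not> ?v q} = (if w' then m else Suc m)"
  proof -
    have "{q\<in>{1..Suc i}. \<not> ?v q} =
        (if w' then {q\<in>{1..i}. \<not> v q} else insert (Suc i) {q\<in>{1..i}. \<not> v q})"
      by (auto simp: le_Suc_eq)
    then show ?thesis using j(7) by simp
  qed
  ultimately show ?case
    by (intro exI[of _ ?j] exI[of _ ?v] conjI) (assumption | simp)+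
qed

text \<open>
  The signs \<open>v\<close> along the support \<open>j\<close> obey the rule for circuits of the reoriented matrix, so they
  are the signs of an actual circuit, of which a neighborly reorientation bounds the negative part.
\<close>

lemma neighborly_less_card:
  assumes A: "sign_matrix r n A"
    and nb: "neighborly k (reorient R (matrix_om r n A))"
    and j: "strict_mono_on {1..r+1} j" "j ` {1..r+1} \<subseteq> {1..n}"
    and v: "\<forall>q\<in>{1..r}. v (q+1) \<longleftrightarrow> (v q \<longleftrightarrow> pos_entry A R q (j q) \<noteq> pos_entry A R q (j (q+1)))"
  shows "k < card {q\<in>{1..r+1}. \<not> v q}"
proof -
  have inj: "inj_on j {1..r+1}"
    using j(1) by (rule strict_mono_on_imp_inj_on)
  \<comment> \<open>\<open>Y\<close> is the reoriented circuit, and \<open>X\<close> the circuit before reorientation.\<close>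
  define Y :: "nat \<Rightarrow> int" where "Y e = (if e \<in> j ` {1..r+1} then
      (if v (the_inv_into {1..r+1} j e) then 1 else -1) else 0)" for e
  define X where "X e = (if e \<in> R then - Y e else Y e)" for e
  have Yj: "Y (j q) = (if v q then 1 else -1)" if "q \<in> {1..r+1}" for q
    using that inj by (simp add: Y_def the_inv_into_f_f)
  have "sign_vector_on {1..n} X"
    using j(2) by (auto simp: sign_vector_on_def X_def Y_def split: if_splits)
  moreover have "supp X = j ` {1..r+1}"
    by (auto simp: supp_def pos_part_def neg_part_def X_def Y_def split: if_splits)
  moreover have "X (j (q+1)) = - X (j q) * A q (j q) * A q (j (q+1))" if q: "q \<in> {1..r}" for q
  proof -
    have "j q \<in> {1..n}" "j (q+1) \<in> {1..n}"
      using q j(2) by (auto simp: image_subset_iff)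
    then have "A q (j q) \<in> {1,-1}" "A q (j (q+1)) \<in> {1,-1}"
      using A q by (auto simp: sign_matrix_def)
    moreover have "q \<in> {1..r+1}" "q+1 \<in> {1..r+1}" using q by auto
    ultimately show ?thesis
      using bspec[OF v q] by (auto simp: X_def Yj pos_entry_def)
  qed
  ultimately have "X \<in> circuits (matrix_om r n A)"
    using j(1) unfolding matrix_om_def has_support_def by auto
  moreover have "Y = (\<lambda>e. if e \<in> R then - X e else X e)"
    by (auto simp: X_def)
  ultimately have "Y \<in> circuits (reorient R (matrix_om r n A))"
    by (auto simp: reorient_def)
  then have "k < card (neg_part Y)"
    using nb by (auto simp: neighborly_def)
  also have "neg_part Y = j ` {q\<in>{1..r+1}. \<not> v q}"
  proof -
    have "e \<in> neg_part Y \<longleftrightarrow> (\<exists>q\<in>{1..r+1}. e = j q \<and> Y (j q) < 0)" for e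
      by (auto simp: neg_part_def Y_def split: if_splits)
    moreover have "Y (j q) < 0 \<longleftrightarrow> \<not> v q" if "q \<in> {1..r+1}" for q
      using Yj[OF that] by simp
    ultimately show ?thesis by blast
  qed
  also have "card \<dots> = card {q\<in>{1..r+1}. \<not> v q}"
    by (rule card_image, rule inj_on_subset[OF inj]) auto
  finally show ?thesis .
qed

lemma neighborly_less_signed_chain:
  assumes "sign_matrix r n A" "neighborly k (reorient R (matrix_om r n A))"
    and ch: "signed_chain A R (r+1) c w m" and "c \<le> n"
  shows "k < m"
proof -
  obtain j v where j: "strict_mono_on {1..r+1} j" "j ` {1..r+1} \<subseteq> {1..c}"
    "\<forall>q\<in>{1..<r+1}. v (q+1) \<longleftrightarrow> (v q \<longleftrightarrow> pos_entry A R q (j q) \<noteq> pos_entry A R q (j (q+1)))"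
    "card {q\<in>{1..r+1}. \<not> v q} = m"
    using signed_chain_sequence[OF ch] by blast
  have "j ` {1..r+1} \<subseteq> {1..n}" using j(2) \<open>c \<le> n\<close> by fastforce
  moreover have "{1..<r+1} = {1..r}" by auto
  ultimately show ?thesis
    using neighborly_less_card[OF assms(1,2) j(1), of v] j(3,4) by metis
qed

text \<open>
  The chain consists of column \<open>1\<close> and the turns up to \<open>c\<close>. Between two turns the entry in the
  current row is constant, so each turn differs in sign from the previous one in the row that
  joins them, and the circuit sign stays positive.
\<close>

lemma signed_chain_along_travel:
  assumes "1 \<le> c"
  shows "\<exists>d\<le>c. 1 \<le> d \<and> travel_row A R d = travel_row A R c \<and>
    signed_chain A R (travel_row A R c) d True 0"
  using assms
proof (induction c rule: dec_induct)
  case base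
  then show ?case
    using signed_chain.start[of 1 A R] by auto
next
  case (step c)
  then obtain d where d: "d \<le> c" "1 \<le> d" "travel_row A R d = travel_row A R c"
    "signed_chain A R (travel_row A R c) d True 0" by blast
  show ?case
  proof (cases "travel_row A R (Suc c) = travel_row A R c")
    case True
    then show ?thesis
      using d by (intro exI[of _ d]) (simp del: travel_row.simps)
  next
    case False
    then have turn: "pos_entry A R (travel_row A R c) c \<noteq> pos_entry A R (travel_row A R c) (Suc c)"
      and row: "travel_row A R (Suc c) = Suc (travel_row A R c)"
      by (auto split: if_splits)
    have "pos_entry A R (travel_row A R c) d \<noteq> pos_entry A R (travel_row A R c) (Suc c)"
      using pos_entry_constant_on_row[OF d(2,1,3)] turn by simp
    then have "signed_chain A R (Suc (travel_row A R c)) (Suc c) True 0"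
      using signed_chain.step[OF d(4), of "Suc c" True] d(1) by simp
    then show ?thesis
      using row by (intro exI[of _ "Suc c"]) (simp del: travel_row.simps)
  qed
qed

lemma signed_chain_one_more:
  assumes "signed_chain A R i c w m"
  shows "\<exists>w' m'. m' \<le> m + 1 \<and> signed_chain A R (Suc i) (Suc c) w' m'"
proof -
  define w' where "w' \<longleftrightarrow> (w \<longleftrightarrow> pos_entry A R i c \<noteq> pos_entry A R i (Suc c))"
  have "signed_chain A R (Suc i) (Suc c) w' (if w' then m else Suc m)"
    by (rule signed_chain.step[OF assms lessI w'_def])
  then show ?thesis
    by (intro exI[of _ w'] exI[of _ "if w' then m else Suc m"]) simp
qed

text \<open>
  If one of the next two columns continues the chain with a positive sign, take it and the column
  after it. Otherwise the first two of the three columns both give a negative sign, and in the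
  following row two of the three entries agree by the pigeonhole principle; taking these two
  columns, the sign is negative first and then returns to positive.
\<close>

lemma signed_chain_two_more:
  assumes ch: "signed_chain A R i c w m"
  shows "\<exists>d w' m'. d \<le> c + 3 \<and> m' \<le> m + 1 \<and> signed_chain A R (i + 2) d w' m'"
proof -
  define sgn where "sgn p \<longleftrightarrow> (w \<longleftrightarrow> pos_entry A R i c \<noteq> pos_entry A R i p)" for p
  define sgn2 where "sgn2 p q \<longleftrightarrow> (sgn p \<longleftrightarrow> pos_entry A R (Suc i) p \<noteq> pos_entry A R (Suc i) q)" for p q
  have "\<exists>p q. c < p \<and> p < q \<and> q \<le> c + 3 \<and> (sgn p \<or> sgn2 p q)"
  proof (cases "sgn (c+1) \<or> sgn (c+2)")
    case True
    then show ?thesis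
    proof
      assume "sgn (c+1)"
      then show ?thesis by (intro exI[of _ "c+1"] exI[of _ "c+2"]) simp
    next
      assume "sgn (c+2)"
      then show ?thesis by (intro exI[of _ "c+2"] exI[of _ "c+3"]) simp
    qed
  next
    case False
    then have "sgn2 (c+1) (c+2) \<or> sgn2 (c+1) (c+3) \<or> sgn2 (c+2) (c+3)"
      unfolding sgn2_def by blast
    then obtain p q where "(p, q) \<in> {(c+1, c+2), (c+1, c+3), (c+2, c+3)}" "sgn2 p q"
      by blast
    then show ?thesis by (intro exI[of _ p] exI[of _ q]) auto
  qed
  then obtain p q where pq: "c < p" "p < q" "q \<le> c + 3" "sgn p \<or> sgn2 p q" by blast
  let ?m = "if sgn p then m else Suc m"
  have "signed_chain A R (Suc i) p (sgn p) ?m"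
    using signed_chain.step[OF ch pq(1)] sgn_def by blast
  then have "signed_chain A R (Suc (Suc i)) q (sgn2 p q) (if sgn2 p q then ?m else Suc ?m)"
    using signed_chain.step pq(2) sgn2_def by blast
  then show ?thesis
    using pq(3,4)
    by (intro exI[of _ q] exI[of _ "sgn2 p q"] exI[of _ "if sgn2 p q then ?m else Suc ?m"]) auto
qed

lemma signed_chain_triples:
  assumes "signed_chain A R i c w m"
  shows "\<exists>d w' m'. d \<le> c + 3 * t \<and> m' \<le> m + t \<and> signed_chain A R (i + 2 * t) d w' m'"
proof (induction t)
  case 0
  then show ?case using assms by auto
next
  case (Suc t)
  then obtain d w' m' where d: "d \<le> c + 3 * t" "m' \<le> m + t" "signed_chain A R (i + 2 * t) d w' m'"
    by blast
  then obtain d2 w2 m2 where "d2 \<le> d + 3" "m2 \<le> m' + 1" "signed_chain A R (i + 2 * t + 2) d2 w2 m2"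
    using signed_chain_two_more by blast
  then show ?case using d
    by (intro exI[of _ d2] exI[of _ w2] exI[of _ m2]) (auto simp: add.assoc)
qed

lemma signed_chain_of_turns:
  assumes T: "turns A R n \<subseteq> {2..N}" and N: "1 \<le> N" "N \<le> n"
  shows "\<exists>d\<le>N. signed_chain A R (Suc (card (turns A R n))) d True 0"
proof -
  have "turns A R N = turns A R n"
    using T turns_restrict[OF N(2)] by fastforce
  then show ?thesis
    using signed_chain_along_travel[OF N(1), of A R] by (auto simp: travel_row_eq_card)
qed

text \<open>
  With \<open>r\<close> turns the travel enters row \<open>r + 1\<close>, and its chain then is a whole circuit without
  negative elements.
\<close>

lemma neighborly_card_turns_less:
  assumes "1 \<le> n" "sign_matrix r n A" "neighborly k (reorient R (matrix_om r n A))"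
  shows "card (turns A R n) < r"
proof (rule ccontr)
  assume "\<not> ?thesis"
  then have ge: "r + 1 \<le> travel_row A R n" by (simp add: travel_row_eq_card)
  have "\<exists>c. travel_row A R c = r + 1 \<and> c \<le> n"
  proof (cases "r = 0")
    case True
    then show ?thesis by (intro exI[of _ 0]) simp
  next
    case False
    define c where "c = (LEAST c. r + 1 \<le> travel_row A R c)"
    have c: "r + 1 \<le> travel_row A R c" "c \<le> n"
      unfolding c_def using ge by (auto intro: LeastI Least_le)
    with False have "c \<noteq> 0" by (intro notI) simp
    then obtain b where b: "c = Suc b" by (cases c) auto
    then have "\<not> r + 1 \<le> travel_row A R b"
      unfolding c_def by (metis lessI not_less_Least)
    then have "travel_row A R c = r + 1"
      using c(1) b by (auto split: if_splits)
    then show ?thesis using c(2) by blast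
  qed
  then obtain c where c: "travel_row A R c = r + 1" "c \<le> n" by blast
  have "\<exists>d\<le>n. signed_chain A R (r + 1) d True 0"
  proof (cases "c = 0")
    case True
    then have "r = 0" using c by simp
    then show ?thesis using assms(1) signed_chain.start[of 1 A R] by auto
  next
    case False
    then obtain d where "d \<le> c" "signed_chain A R (r + 1) d True 0"
      using signed_chain_along_travel[of c A R] c(1) by auto
    then show ?thesis using c(2) le_trans by blast
  qed
  then show False
    using neighborly_less_signed_chain[OF assms(2,3)] by blast
qed

section \<open>The upper bound for Lawrence oriented matroids\<close>

text \<open>
  In terms of \<open>m\<close> these are the sets of \<open>r - 2 * m\<close> turns in \<open>{2..n - 3 * m}\<close>, for \<open>i = 2 * m + 3\<close>,
  and the sets of \<open>r + 1 - 2 * m\<close> turns in \<open>{2..n + 2 - 3 * m}\<close>, for \<open>i = 2 * m + 2\<close>.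
\<close>

definition early_turns :: "nat \<Rightarrow> nat \<Rightarrow> nat \<Rightarrow> nat set set" where
  "early_turns r n i =
     {T. T \<subseteq> {2..n + 2 + i mod 2 - 3 * ((i - 1) div 2)} \<and> card T = r + 3 - i}"

text \<open>
  The chain along the travel ends at the last turn without negative signs, and enough columns are
  left to extend it to a circuit: by triples of columns that yield two elements each if \<open>i\<close> is odd,
  and by one single column followed by such triples if \<open>i\<close> is even. Each of these steps costs at
  most one negative sign.
\<close>

lemma early_turns_not_neighborly:
  assumes A: "sign_matrix r n A" and rk: "2 * k + 1 \<le> r" and n: "2 * r - 1 \<le> n"
    and i: "i \<in> {4..2*k+3}" and T: "turns A R n \<in> early_turns r n i"
  shows "\<not> neighborly k (reorient R (matrix_om r n A))"
proof
  assume nb: "neighborly k (reorient R (matrix_om r n A))"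
  have "\<exists>d\<le>n. \<exists>w m. m \<le> k \<and> signed_chain A R (r + 1) d w m"
  proof (cases "even i")
    case False
    then obtain m' where "i = 2 * m' + 1" by (elim oddE)
    then obtain m where im: "i = 2 * m + 3" and m: "1 \<le> m" "m \<le> k"
      using i by (intro that[of "m' - 1"]) auto
    have eqs: "n + 2 + i mod 2 - 3 * ((i - 1) div 2) = n - 3 * m" "r + 3 - i = r - 2 * m"
      using im by auto
    have "1 \<le> n - 3 * m" using m rk n by linarith
    then obtain d where d: "d \<le> n - 3 * m" "signed_chain A R (Suc (r - 2 * m)) d True 0"
      using signed_chain_of_turns[of A R n "n - 3 * m"] T eqs by (auto simp: early_turns_def)
    obtain d' w' m' where "d' \<le> d + 3 * m" "m' \<le> 0 + m"
      "signed_chain A R (Suc (r - 2 * m) + 2 * m) d' w' m'"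
      using signed_chain_triples[OF d(2), of m] by blast
    moreover have "Suc (r - 2 * m) + 2 * m = r + 1" "d + 3 * m \<le> n"
      using m rk n d(1) by auto
    ultimately show ?thesis using m(2) by (metis add_0 le_trans)
  next
    case True
    then obtain m' where "i = 2 * m'" by (elim evenE)
    \<comment> \<open>Here \<open>m\<close> counts the triples only; the single column is extra.\<close>
    then obtain m where im: "i = 2 * m + 4" and m: "m + 1 \<le> k"
      using i by (intro that[of "m' - 2"]) auto
    have eqs: "n + 2 + i mod 2 - 3 * ((i - 1) div 2) = n - 3 * m - 1" "r + 3 - i = r - 2 * m - 1"
      using im by auto
    have "1 \<le> n - 3 * m - 1" using m rk n by linarith
    then obtain d where d: "d \<le> n - 3 * m - 1" "signed_chain A R (Suc (r - 2 * m - 1)) d True 0"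
      using signed_chain_of_turns[of A R n "n - 3 * m - 1"] T eqs by (auto simp: early_turns_def)
    obtain w1 m1 where 1: "m1 \<le> 0 + 1" "signed_chain A R (Suc (Suc (r - 2 * m - 1))) (Suc d) w1 m1"
      using signed_chain_one_more[OF d(2)] by blast
    obtain d' w' m' where "d' \<le> Suc d + 3 * m" "m' \<le> m1 + m"
      "signed_chain A R (Suc (Suc (r - 2 * m - 1)) + 2 * m) d' w' m'"
      using signed_chain_triples[OF 1(2), of m] by blast
    moreover have "Suc (Suc (r - 2 * m - 1)) + 2 * m = r + 1" "Suc d + 3 * m \<le> n" "m1 + m \<le> k"
      using m rk n d(1) 1(1) by auto
    ultimately show ?thesis by (metis le_trans)
  qed
  then show False
    using neighborly_less_signed_chain[OF A nb] by (meson not_le)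
qed

lemma card_small_subsets:
  assumes "finite S"
  shows "card {T. T \<subseteq> S \<and> card T < q} = (\<Sum>i<q. card S choose i)"
proof -
  have "{T. T \<subseteq> S \<and> card T < q} = (\<Union>i\<in>{..<q}. {T. T \<subseteq> S \<and> card T = i})" by auto
  also have "card \<dots> = (\<Sum>i<q. card {T. T \<subseteq> S \<and> card T = i})"
    using assms by (intro card_UN_disjoint) auto
  finally show ?thesis using assms by (simp add: n_subsets)
qed

text \<open>
  The sets of turns of neighborly reorientations have fewer than \<open>r\<close> elements and avoid all the
  families of early turns. The latter are disjoint because the cardinality of a set of
  turns, which is \<open>r + 3 - i > 0\<close>, recovers \<open>i\<close>.
\<close>

lemma num_neighborly_matrix_om_le:
  assumes A: "sign_matrix r n A" and k: "1 \<le> k" and rk: "2 * k + 1 \<le> r" and n: "2 * r - 1 \<le> n"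
  shows "num_neighborly (matrix_om r n A) k
      + 2 * (\<Sum>i=4..2*k+3. (n + 1 + i mod 2 - 3 * ((i - 1) div 2)) choose (r + 3 - i))
    \<le> 2 * (\<Sum>i<r. (n - 1) choose i)"
proof -
  have n1: "1 \<le> n" using n rk by linarith
  define G where "G = {T. T \<subseteq> {2..n} \<and> card T < r}"
  define B where "B = (\<Union>i\<in>{4..2*k+3}. early_turns r n i)"
  have fin: "finite (early_turns r n i)" for i
    unfolding early_turns_def
    by (rule finite_subset[of _ "Pow {2..n + 2 + i mod 2 - 3 * ((i - 1) div 2)}"]) auto
  have BG: "B \<subseteq> G"
  proof
    fix T assume "T \<in> B"
    then obtain i where i: "4 \<le> i" "i \<le> 2 * k + 3"
      "T \<subseteq> {2..n + 2 + i mod 2 - 3 * ((i - 1) div 2)}" "card T = r + 3 - i"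
      by (auto simp: B_def early_turns_def)
    have "1 \<le> (i - 1) div 2" using i by auto
    then have "n + 2 + i mod 2 - 3 * ((i - 1) div 2) \<le> n" by linarith
    then show "T \<in> G" using i rk by (auto simp: G_def)
  qed
  have "{R. R \<subseteq> ground (matrix_om r n A) \<and> neighborly k (reorient R (matrix_om r n A))}
      \<subseteq> {R. R \<subseteq> {1..n} \<and> turns A R n \<in> G - B}"
    using neighborly_card_turns_less[OF n1 A] early_turns_not_neighborly[OF A rk n] turns_subset
    by (fastforce simp: matrix_om_def G_def B_def)
  then have "num_neighborly (matrix_om r n A) k \<le> card {R. R \<subseteq> {1..n} \<and> turns A R n \<in> G - B}"
    unfolding num_neighborly_def by (rule card_mono[rotated]) auto
  also have "\<dots> = 2 * card (G - B)"
    by (rule card_turns_in[OF n1]) (auto simp: G_def)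
  also have "card (G - B) = card G - card B"
    using BG fin by (intro card_Diff_subset) (auto simp: B_def)
  finally have le: "num_neighborly (matrix_om r n A) k \<le> 2 * (card G - card B)" .
  have "card B \<le> card G"
    by (rule card_mono[OF _ BG]) (auto simp: G_def)
  moreover have "card G = (\<Sum>i<r. (n - 1) choose i)"
    using card_small_subsets[of "{2..n}" r] by (simp add: G_def)
  moreover have "card B = (\<Sum>i=4..2*k+3. (n + 1 + i mod 2 - 3 * ((i - 1) div 2)) choose (r + 3 - i))"
  proof -
    have "card B = (\<Sum>i=4..2*k+3. card (early_turns r n i))"
      unfolding B_def using fin rk by (intro card_UN_disjoint) (auto simp: early_turns_def)
    also have "\<dots> = (\<Sum>i=4..2*k+3. (n + 1 + i mod 2 - 3 * ((i - 1) div 2)) choose (r + 3 - i))"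
    proof (rule sum.cong[OF refl])
      fix i assume "i \<in> {4..2*k+3}"
      then show "card (early_turns r n i) =
          (n + 1 + i mod 2 - 3 * ((i - 1) div 2)) choose (r + 3 - i)"
        unfolding early_turns_def by (subst n_subsets) auto
    qed
    finally show ?thesis .
  qed
  ultimately show ?thesis using le by simp
qed

section \<open>The lower bound for alternating oriented matroids\<close>

text \<open>
  Each change involves exactly one index at which \<open>w\<close> is false, and such an index takes part in at
  most two changes. If \<open>w\<close> is false at the end of the sequence, then the last such index takes
  part in at most one; the summand for this case is what carries the induction.
\<close>

lemma changes_le_twice_false:
  fixes w :: "nat \<Rightarrow> bool"
  assumes "1 \<le> q"
  shows "card {i\<in>{1..<q}. w (i+1) \<noteq> w i} + (if w q then 0 else 1) \<le> 2 * card {i\<in>{1..q}. \<not> w i}"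
  using assms
proof (induction q rule: dec_induct)
  case base
  have "{i\<in>{1..1}. \<not> w i} = (if w 1 then {} else {1})" by auto
  then show ?case by simp
next
  case (step q)
  have "{i\<in>{1..<Suc q}. w (i+1) \<noteq> w i} = (if w (q+1) \<noteq> w q
      then insert q {i\<in>{1..<q}. w (i+1) \<noteq> w i} else {i\<in>{1..<q}. w (i+1) \<noteq> w i})"
    using step.hyps by (auto simp: less_Suc_eq)
  moreover have "{i\<in>{1..Suc q}. \<not> w i} = (if w (Suc q) then {i\<in>{1..q}. \<not> w i}
      else insert (Suc q) {i\<in>{1..q}. \<not> w i})"
    by (auto simp: le_Suc_eq)
  ultimately show ?case using step.IH by (auto split: if_splits)
qed

abbreviation ones :: "nat \<Rightarrow> nat \<Rightarrow> int" where "ones \<equiv> \<lambda>_ _. 1"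

text \<open>
  If exactly one of two consecutive columns \<open>j i < j (i+1)\<close> belongs to \<open>R\<close>, then the travel
  through the constant matrix has to turn between them.
\<close>

lemma card_separated_pairs_less_travel_row:
  fixes j :: "nat \<Rightarrow> nat"
  assumes "1 \<le> q" "strict_mono_on {1..q} j" "1 \<le> j 1"
  shows "card {i\<in>{1..<q}. (j (i+1) \<in> R) \<noteq> (j i \<in> R)} < travel_row ones R (j q)"
  using assms
proof (induction q rule: dec_induct)
  case base
  then show ?case by (simp add: travel_row_eq_card)
next
  case (step q)
  have mono: "strict_mono_on {1..q} j"
    using step.prems by (auto simp: strict_mono_on_def)
  have lt: "j q < j (Suc q)"
    using step by (auto simp: strict_mono_on_def)
  have "1 \<le> j q"
  proof (cases "q = 1")
    case False
    then have "j 1 < j q" using step.hyps mono by (auto simp: strict_mono_on_def)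
    then show ?thesis using step.prems by simp
  qed (use step.prems in simp)
  then have "travel_row ones R (j q) < travel_row ones R (j (Suc q))"
    if "(j (Suc q) \<in> R) \<noteq> (j q \<in> R)"
    using pos_entry_constant_on_row[of "j q" "j (Suc q)" ones R] that lt
      travel_row_mono[of "j q" "j (Suc q)" ones R] by (auto simp: pos_entry_def le_less)
  moreover have "travel_row ones R (j q) \<le> travel_row ones R (j (Suc q))"
    using lt by (intro travel_row_mono) simp
  moreover have "{i\<in>{1..<Suc q}. (j (i+1) \<in> R) \<noteq> (j i \<in> R)} =
      (if (j (Suc q) \<in> R) \<noteq> (j q \<in> R) then insert q {i\<in>{1..<q}. (j (i+1) \<in> R) \<noteq> (j i \<in> R)}
       else {i\<in>{1..<q}. (j (i+1) \<in> R) \<noteq> (j i \<in> R)})"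
    using step.hyps by (auto simp: less_Suc_eq)
  ultimately show ?case using step.IH[OF mono] step.prems by (auto split: if_splits)
qed

text \<open>
  A reoriented alternating circuit changes its sign between consecutive elements of its support
  unless \<open>R\<close> separates them, which happens at most as often as there are turns. So there are at
  least \<open>2 * k + 1\<close> changes among the \<open>r\<close> consecutive pairs.
\<close>

lemma alternating_neighborly:
  assumes few: "card (turns ones R n) + 2 * k < r"
  shows "neighborly k (reorient R (alternating_om r n))"
proof -
  have "k < card (pos_part Y) \<and> k < card (neg_part Y)"
    if circ: "Y \<in> circuits (reorient R (alternating_om r n))" for Y
  proof -
    obtain X j where Y: "Y = (\<lambda>e. if e \<in> R then - X e else X e)"
      and X: "sign_vector_on {1..n} X" and j: "strict_mono_on {1..r+1} j" "supp X = j ` {1..r+1}"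
      and alt: "\<forall>i\<in>{1..r}. X (j i) = - X (j (i+1))"
      using circ by (auto simp: reorient_def alternating_om_def has_support_def)
    have Xj: "X (j i) \<in> {1,-1} \<and> j i \<in> {1..n}" if "i \<in> {1..r+1}" for i
    proof -
      have "j i \<in> supp X" using that j(2) by simp
      then have "X (j i) \<noteq> 0" by (auto simp: supp_def pos_part_def neg_part_def)
      then show ?thesis using X by (auto simp: sign_vector_on_def)
    qed
    define w where "w i \<longleftrightarrow> 0 < Y (j i)" for i
    \<comment> \<open>The pairs separated by \<open>R\<close> and the changes of sign of \<open>Y\<close> are complementary.\<close>
    let ?E = "{i\<in>{1..<r+1}. (j (i+1) \<in> R) \<noteq> (j i \<in> R)}"
    let ?C = "{i\<in>{1..<r+1}. w (i+1) \<noteq> w i}"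
    have chg: "w (i+1) \<noteq> w i \<longleftrightarrow> ((j (i+1) \<in> R) = (j i \<in> R))" if "i \<in> {1..<r+1}" for i
      using bspec[OF alt, of i] Xj[of i] that by (auto simp: w_def Y)
    have "card ?E < travel_row ones R (j (r+1))"
      using card_separated_pairs_less_travel_row[of "r+1" j R] j(1) Xj[of 1] by simp
    also have "\<dots> \<le> travel_row ones R n"
      using Xj[of "r+1"] by (intro travel_row_mono) simp
    finally have E: "card ?E + 2 * k < r"
      using few by (simp add: travel_row_eq_card)
    have "card ?C + card ?E = card (?C \<union> ?E)"
      using chg by (intro card_Un_disjoint[symmetric]) auto
    also have "?C \<union> ?E = {1..<r+1}" using chg by blast
    finally have C: "2 * k < card ?C" using E by simp
    have inj: "inj_on j {1..r+1}" using j(1) by (rule strict_mono_on_imp_inj_on)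
    have mem: "e \<in> j ` {1..r+1}" if "Y e \<noteq> 0" for e
      using that j(2) by (auto simp: Y supp_def pos_part_def neg_part_def split: if_splits)
    have nz: "Y (j i) \<noteq> 0" if "i \<in> {1..r+1}" for i
      using Xj[OF that] by (auto simp: Y)
    have "e \<in> pos_part Y \<longleftrightarrow> (\<exists>i\<in>{1..r+1}. e = j i \<and> w i)" for e
      using mem[of e] by (auto simp: pos_part_def w_def)
    then have "pos_part Y = j ` {i\<in>{1..r+1}. w i}" by blast
    moreover have "e \<in> neg_part Y \<longleftrightarrow> (\<exists>i\<in>{1..r+1}. e = j i \<and> \<not> w i)" for e
      using mem[of e] nz by (auto simp: neg_part_def w_def not_less le_less)
    then have "neg_part Y = j ` {i\<in>{1..r+1}. \<not> w i}" by blast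
    ultimately have "card (pos_part Y) = card {i\<in>{1..r+1}. w i}"
      "card (neg_part Y) = card {i\<in>{1..r+1}. \<not> w i}"
      by (auto intro!: card_image inj_on_subset[OF inj])
    then show ?thesis
      using changes_le_twice_false[of "r+1" w] changes_le_twice_false[of "r+1" "\<lambda>i. \<not> w i"] C
      by (auto split: if_splits)
  qed
  then show ?thesis by (auto simp: neighborly_def)
qed

lemma num_neighborly_alternating_ge:
  assumes "1 \<le> n"
  shows "2 * (\<Sum>i<r - 2 * k. (n - 1) choose i) \<le> num_neighborly_alternating r n k"
proof -
  have "2 * (\<Sum>i<r - 2 * k. (n - 1) choose i) = 2 * card {T. T \<subseteq> {2..n} \<and> card T < r - 2 * k}"
    using card_small_subsets[of "{2..n}"] by simp
  also have "\<dots> = card {R. R \<subseteq> {1..n} \<and> turns ones R n \<in> {T. T \<subseteq> {2..n} \<and> card T < r - 2 * k}}"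
    by (rule card_turns_in[OF assms, symmetric]) auto
  also have "\<dots> \<le> num_neighborly_alternating r n k"
    unfolding num_neighborly_alternating_def num_neighborly_def
  proof (rule card_mono)
    show "finite {R. R \<subseteq> ground (alternating_om r n) \<and> neighborly k (reorient R (alternating_om r n))}"
      by (simp add: alternating_om_def)
    show "{R. R \<subseteq> {1..n} \<and> turns ones R n \<in> {T. T \<subseteq> {2..n} \<and> card T < r - 2 * k}}
        \<subseteq> {R. R \<subseteq> ground (alternating_om r n) \<and> neighborly k (reorient R (alternating_om r n))}"
    proof safe
      fix R e assume R: "R \<subseteq> {1..n}"
      show "e \<in> ground (alternating_om r n)" if "e \<in> R"
        using R that by (auto simp: alternating_om_def)
      show "neighborly k (reorient R (alternating_om r n))" if "card (turns ones R n) < r - 2 * k"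
        using that by (intro alternating_neighborly) simp
    qed
  qed
  finally show ?thesis .
qed

section \<open>Comparison of the two bounds\<close>

theorem theorem2p14:
  fixes r k n :: nat and M :: "nat signed_system"
  assumes "r \<ge> 2 * k + 1" and "2 * k + 1 \<ge> 3" and "n \<ge> 2 * r - 1"
    and "lawrence_om r n M"
  shows "int (num_neighborly M k) \<le> int (num_neighborly_alternating r n k)
    + 2 * ((\<Sum>i=r-2*k..r-1. int ((n - 1) choose i))
         - (\<Sum>i=4..2*k+3. int ((n + 1 + i mod 2 - 3 * ((i - 1) div 2)) choose (r + 3 - i))))"
proof -
  obtain A where A: "sign_matrix r n A" and M: "M = matrix_om r n A"
    using assms(4) by (auto simp: lawrence_om_def)
  have union: "{..<r} = {..<r - 2 * k} \<union> {r-2*k..r-1}"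
    using assms(1) by auto
  have split: "(\<Sum>i<r. (n - 1) choose i) =
      (\<Sum>i<r - 2 * k. (n - 1) choose i) + (\<Sum>i=r-2*k..r-1. (n - 1) choose i)"
    by (subst union) (rule sum.union_disjoint; auto)
  have "num_neighborly M k
      + 2 * (\<Sum>i=4..2*k+3. (n + 1 + i mod 2 - 3 * ((i - 1) div 2)) choose (r + 3 - i))
    \<le> num_neighborly_alternating r n k + 2 * (\<Sum>i=r-2*k..r-1. (n - 1) choose i)"
  proof -
    have "1 \<le> k" "1 \<le> n" using assms(1-3) by linarith+
    moreover have "a + 2 * b \<le> e + 2 * d" if "a + 2 * b \<le> 2 * (c + d)" "2 * c \<le> e"
      for a b c d e :: nat
      using that by (simp add: distrib_left)
    ultimately show ?thesis
      using num_neighborly_matrix_om_le[OF A \<open>1 \<le> k\<close> assms(1,3)]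
        num_neighborly_alternating_ge[OF \<open>1 \<le> n\<close>, of r k]
      unfolding split M by blast
  qed
  then have "int (num_neighborly M k
      + 2 * (\<Sum>i=4..2*k+3. (n + 1 + i mod 2 - 3 * ((i - 1) div 2)) choose (r + 3 - i)))
    \<le> int (num_neighborly_alternating r n k + 2 * (\<Sum>i=r-2*k..r-1. (n - 1) choose i))"
    by (simp only: of_nat_le_iff)
  then show ?thesis by (simp add: of_nat_sum)
qed

end
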